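(* Let $\lambda\in\overline{\mathbb{D}}$ and let $X$ be a bounded linear operator on $H^2(\mathbb{D})$. (1) If $|\lambda|=1$, then $X$ is an extended $\lambda$-eigenoperator of $B$ if and only if $X=R_\lambda\phi(B)$ for some nonzero $\phi\in H^\infty(\mathbb{D})$. (2) If $|\lambda|<1$, then $X$ is an extended $\lambda$-eigenoperator of $B$ if and only if $X=R_\lambda\phi(B)$ for some nonzero $\phi\in H^2(\mathbb{D})$; in particular, for every $\phi\in H^2(\mathbb{D})$ the expression $R_\lambda\phi(B)$ defines a bounded operator on $H^2(\mathbb{D})$.
   Context: $\mathbb{D}$ is the open unit disk and $H^2(\mathbb{D})$ is the Hardy space with orthonormal basis $(z^n)_{n\ge 0}$. $B$ is the backward shift: $B1=0$, $Bz^n=z^{n-1}$ for $n\ge1$. An extended $\lambda$-eigenoperator of $B$ is a bounded linear operator $X\neq0$ on $H^2(\mathbb{D})$ with $BX=\lambda XB$. $R_\lambda$ is the dilation operator $R_\lambda f(z)=f(\lambda z)$ (so $R_\lambda z^n=\lambda^n z^n$, with $0^0=1$). For $\phi(z)=\sum_{k\ge0}c_kz^k$ in $H^\infty(\mathbb{D})$, $\phi(B)$ denotes the bounded operator $M_{\overline{\phi}}^\star$, the adjoint of multiplication by $\overline{\phi}(z):=\overline{\phi(\overline{z})}$; it is the element $\sum_k c_kB^k$ of the commutant of $B$. For $\phi(z)=\sum_{k\ge0}c_kz^k\in H^2(\mathbb{D})$ and $|\lambda|<1$, $R_\lambda\phi(B)$ denotes the operator given on the monomials by $R_\lambda\phi(B)z^n=\sum_{k=0}^n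 c_k\lambda^{n-k}z^{n-k}$ and extended continuously to $H^2(\mathbb{D})$; equivalently, it is the operator whose adjoint is $f\mapsto \overline{\phi}\cdot R_{\overline{\lambda}}f$. *)

theory Defs
  imports "HOL-Complex_Analysis.Complex_Analysis"
begin

section \<open>The Hardy space of the unit disk\<close>

abbreviation unit_disk :: "complex set" where
  "unit_disk \<equiv> ball 0 1"

abbreviation taylor_coeff :: "(complex \<Rightarrow> complex) \<Rightarrow> nat \<Rightarrow> complex" where
  "taylor_coeff f n \<equiv> fps_nth (fps_expansion f 0) n"

abbreviation square_summable :: "(nat \<Rightarrow> complex) \<Rightarrow> bool" where
  "square_summable a \<equiv> summable (\<lambda>n. (cmod (a n))\<^sup>2)"

lemma square_summable_imp_summable:
  assumes "square_summable a" "square_summable b"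
  shows "summable (\<lambda>n. norm (a n * b n))" "summable (\<lambda>n. a n * b n)"
proof -
  show "summable (\<lambda>n. norm (a n * b n))"
  proof (rule summable_comparison_test)
    show "\<exists>N. \<forall>n\<ge>N. norm (norm (a n * b n)) \<le> (cmod (a n))\<^sup>2 + (cmod (b n))\<^sup>2"
    proof (intro exI allI impI)
      fix n
      have "2 * cmod (a n) * cmod (b n) \<le> (cmod (a n))\<^sup>2 + (cmod (b n))\<^sup>2"
        by (rule sum_squares_bound)
      moreover have "0 \<le> cmod (a n) * cmod (b n)" by simp
      ultimately show "norm (norm (a n * b n)) \<le> (cmod (a n))\<^sup>2 + (cmod (b n))\<^sup>2"
        unfolding norm_mult real_norm_def abs_mult abs_norm_cancel by linarith
    qed
  qed (intro summable_add assms)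
  then show "summable (\<lambda>n. a n * b n)" by (rule summable_norm_cancel)
qed

lemma square_summable_power:
  assumes "z \<in> unit_disk"
  shows "square_summable (\<lambda>n. z ^ n)"
proof -
  have "(cmod z)\<^sup>2 < 1"
    using assms by (simp add: power_less_one_iff abs_square_less_1)
  then have "summable (\<lambda>n. ((cmod z)\<^sup>2) ^ n)" by (intro summable_geometric) simp
  then show ?thesis by (simp add: norm_power power_mult[symmetric] mult.commute)
qed

lemma square_summable_add:
  assumes "square_summable a" "square_summable b"
  shows "square_summable (\<lambda>n. a n + b n)"
proof (rule summable_comparison_test)
  show "\<exists>N. \<forall>n\<ge>N. norm ((cmod (a n + b n))\<^sup>2) \<le> 2 * (cmod (a n))\<^sup>2 + 2 * (cmod (b n))\<^sup>2"
  proof (intro exI allI impI)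
    fix n
    have "(cmod (a n + b n))\<^sup>2 \<le> (cmod (a n) + cmod (b n))\<^sup>2"
      by (intro power_mono norm_triangle_ineq) simp
    also have "\<dots> \<le> 2 * (cmod (a n))\<^sup>2 + 2 * (cmod (b n))\<^sup>2"
      using sum_squares_bound[of "cmod (a n)" "cmod (b n)"] by (simp add: power2_sum)
    finally show "norm ((cmod (a n + b n))\<^sup>2) \<le> 2 * (cmod (a n))\<^sup>2 + 2 * (cmod (b n))\<^sup>2"
      by simp
  qed
qed (intro summable_add summable_mult assms)

lemma square_summable_cmult:
  assumes "square_summable a"
  shows "square_summable (\<lambda>n. c * a n)"
  using assms by (simp add: norm_mult power_mult_distrib summable_mult)

lemma taylor_coeff_sums:
  assumes "f holomorphic_on unit_disk" "z \<in> unit_disk"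
  shows "(\<lambda>n. taylor_coeff f n * z ^ n) sums f z"
  using holomorphic_power_series[OF assms] by (simp add: fps_expansion_def)

lemma taylor_coeff_unique:
  assumes sums: "\<And>z. z \<in> unit_disk \<Longrightarrow> (\<lambda>n. a n * z ^ n) sums f z"
  shows "f holomorphic_on unit_disk" "taylor_coeff f n = a n"
proof -
  show hol: "f holomorphic_on unit_disk"
    by (rule power_series_holomorphic) (use sums in auto)
  have "fps_conv_radius (Abs_fps a) \<ge> 1"
    unfolding fps_conv_radius_def
  proof (rule conv_radius_geI_ex')
    fix r :: real assume "0 < r" "ereal r < 1"
    then show "summable (\<lambda>n. fps_nth (Abs_fps a) n * of_real r ^ n)"
      using sums[of "of_real r"] by (auto simp: sums_iff)
  qed
  moreover from this have "fps_conv_radius (Abs_fps a) > 0"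
    using less_le_trans[of 0 "1 :: ereal"] by simp
  moreover have "\<forall>\<^sub>F z in nhds 0. eval_fps (Abs_fps a) z = f z"
  proof -
    have "\<forall>\<^sub>F z in nhds 0. z \<in> unit_disk" by (intro eventually_nhds_in_open) auto
    then show ?thesis
      by eventually_elim (use sums in \<open>auto simp: eval_fps_def sums_iff\<close>)
  qed
  ultimately have "f has_fps_expansion Abs_fps a"
    by (simp add: has_fps_expansion_def)
  from fps_nth_fps_expansion[OF this, of n] show "taylor_coeff f n = a n"
    by (simp add: fps_expansion_def)
qed

text \<open>Elements are functions on the disk; the value \<open>0\<close> off the disk makes the
  representation by total functions unique.\<close>

typedef hardy2 =
  "{f :: complex \<Rightarrow> complex. f holomorphic_on unit_disk \<and> (\<forall>z. z \<notin> unit_disk \<longrightarrow> f z = 0) \<and>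
      square_summable (taylor_coeff f)}"
  morphisms hfun Abs_hardy2
proof -
  have "taylor_coeff (\<lambda>z. 0) n = 0" for n
    by (rule taylor_coeff_unique) auto
  then show ?thesis by (intro exI[of _ "\<lambda>z. 0"]) auto
qed

definition hcoeff :: "hardy2 \<Rightarrow> nat \<Rightarrow> complex" where
  "hcoeff f n = taylor_coeff (hfun f) n"

text \<open>The element of the Hardy space that agrees with \<open>g\<close> on the disk; unspecified if there is none.\<close>

definition on_disk :: "(complex \<Rightarrow> complex) \<Rightarrow> hardy2" where
  "on_disk g = Abs_hardy2 (\<lambda>z. if z \<in> unit_disk then g z else 0)"

lemma square_summable_hcoeff: "square_summable (hcoeff f)"
  using hfun[of f] by (simp add: hcoeff_def)

lemma hfun_holomorphic: "hfun f holomorphic_on unit_disk"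
  using hfun[of f] by simp

lemma hfun_outside: "z \<notin> unit_disk \<Longrightarrow> hfun f z = 0"
  using hfun[of f] by simp

lemma hcoeff_sums: "z \<in> unit_disk \<Longrightarrow> (\<lambda>n. hcoeff f n * z ^ n) sums hfun f z"
  unfolding hcoeff_def by (rule taylor_coeff_sums[OF hfun_holomorphic])

lemma hardy2_eqI:
  assumes "\<And>n. hcoeff f n = hcoeff g n"
  shows "f = g"
proof -
  have "hfun f z = hfun g z" for z
  proof (cases "z \<in> unit_disk")
    case True
    then show ?thesis
      using hcoeff_sums[of z f] hcoeff_sums[of z g] sums_unique2 by (simp add: assms)
  qed (simp add: hfun_outside)
  then show ?thesis by (simp add: hfun_inject[symmetric] ext)
qed

lemma on_disk_power_series:
  assumes "square_summable a" "\<And>z. z \<in> unit_disk \<Longrightarrow> (\<lambda>n. a n * z ^ n) sums g z"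
  shows "hfun (on_disk g) = (\<lambda>z. if z \<in> unit_disk then g z else 0)"
    and "hcoeff (on_disk g) n = a n"
proof -
  define h where "h = (\<lambda>z. if z \<in> unit_disk then g z else 0)"
  have sums: "\<And>z. z \<in> unit_disk \<Longrightarrow> (\<lambda>n. a n * z ^ n) sums h z"
    using assms(2) by (simp add: h_def)
  have *: "h holomorphic_on unit_disk" "taylor_coeff h = a"
    using taylor_coeff_unique[of a h, OF sums] by (auto intro!: ext)
  have "hfun (Abs_hardy2 h) = h"
    using * assms(1) by (intro Abs_hardy2_inverse) (auto simp: h_def)
  then have "hfun (on_disk g) = h"
    unfolding on_disk_def h_def .
  then show "hfun (on_disk g) = (\<lambda>z. if z \<in> unit_disk then g z else 0)"
    and "hcoeff (on_disk g) n = a n"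
    unfolding hcoeff_def using *(2) by (simp_all add: h_def)
qed


subsection \<open>Hilbert space structure\<close>

definition cinner :: "hardy2 \<Rightarrow> hardy2 \<Rightarrow> complex" where
  "cinner f g = (\<Sum>n. hcoeff f n * cnj (hcoeff g n))"

definition scaleH :: "complex \<Rightarrow> hardy2 \<Rightarrow> hardy2" (infixr "*\<^sub>H" 75) where
  "c *\<^sub>H f = on_disk (\<lambda>z. c * hfun f z)"

instantiation hardy2 :: real_inner
begin

definition "0 = on_disk (\<lambda>z. 0)"
definition "f + g = on_disk (\<lambda>z. hfun f z + hfun g z)" for f g :: hardy2
definition "f - g = on_disk (\<lambda>z. hfun f z - hfun g z)" for f g :: hardy2
definition "- f = on_disk (\<lambda>z. - hfun f z)" for f :: hardy2
definition "r *\<^sub>R f = on_disk (\<lambda>z. complex_of_real r * hfun f z)" for f :: hardy2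
definition "inner f g = Re (cinner f g)" for f g :: hardy2
definition "norm f = sqrt (\<Sum>n. (cmod (hcoeff f n))\<^sup>2)" for f :: hardy2
definition "sgn f = inverse (norm f) *\<^sub>R f" for f :: hardy2
definition "dist f g = norm (f - g)" for f g :: hardy2
definition [code del]:
  "(uniformity :: (hardy2 \<times> hardy2) filter) = (INF e\<in>{0<..}. principal {(x, y). dist x y < e})"
definition [code del]:
  "open U \<longleftrightarrow> (\<forall>x\<in>U. eventually (\<lambda>(x', y). x' = x \<longrightarrow> y \<in> U) uniformity)" for U :: "hardy2 set"

lemma hcoeff_scaleH: "hcoeff (c *\<^sub>H f) n = c * hcoeff f n"
  unfolding scaleH_def
  by (rule on_disk_power_series(2))
    (auto intro!: square_summable_cmult square_summable_hcoeff sums_mult hcoeff_sums simp: mult.assoc)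

lemma hcoeff_zero: "hcoeff 0 n = 0"
  unfolding zero_hardy2_def by (rule on_disk_power_series(2)) auto

lemma hcoeff_add: "hcoeff (f + g) n = hcoeff f n + hcoeff g n"
  unfolding plus_hardy2_def
  by (rule on_disk_power_series(2))
    (auto intro!: square_summable_add square_summable_hcoeff sums_add hcoeff_sums simp: distrib_right)

lemma hcoeff_uminus: "hcoeff (- f) n = - hcoeff f n"
  unfolding uminus_hardy2_def
  by (rule on_disk_power_series(2))
    (use square_summable_hcoeff[of f] in \<open>auto intro!: sums_minus hcoeff_sums\<close>)

lemma hcoeff_diff: "hcoeff (f - g) n = hcoeff f n - hcoeff g n"
proof -
  have "square_summable (\<lambda>n. hcoeff f n + - hcoeff g n)"
    using square_summable_hcoeff[of g]
    by (intro square_summable_add square_summable_hcoeff) simp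
  then show ?thesis
    unfolding minus_hardy2_def
    by (intro on_disk_power_series(2)) (auto intro!: sums_diff hcoeff_sums simp: left_diff_distrib)
qed

lemma hcoeff_scaleR: "hcoeff (r *\<^sub>R f) n = complex_of_real r * hcoeff f n"
  using hcoeff_scaleH[of "complex_of_real r" f n] by (simp add: scaleH_def scaleR_hardy2_def)

lemmas hcoeff_simps = hcoeff_scaleH hcoeff_zero hcoeff_add hcoeff_uminus hcoeff_diff hcoeff_scaleR

lemma cinner_summable: "summable (\<lambda>n. hcoeff f n * cnj (hcoeff g n))"
  using square_summable_hcoeff[of f] square_summable_hcoeff[of g]
  by (intro square_summable_imp_summable) simp_all

lemma cinner_self: "cinner f f = complex_of_real (\<Sum>n. (cmod (hcoeff f n))\<^sup>2)"
proof -
  have "(\<lambda>n. complex_of_real ((cmod (hcoeff f n))\<^sup>2)) sums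
      complex_of_real (\<Sum>n. (cmod (hcoeff f n))\<^sup>2)"
    by (intro sums_of_real summable_sums square_summable_hcoeff)
  then show ?thesis
    by (simp add: cinner_def complex_norm_square[symmetric] sums_iff)
qed

lemma cinner_commute: "cinner f g = cnj (cinner g f)"
proof -
  have "(\<lambda>n. cnj (hcoeff g n * cnj (hcoeff f n))) sums cnj (cinner g f)"
    unfolding cinner_def sums_cnj by (rule summable_sums[OF cinner_summable])
  then show ?thesis by (simp add: cinner_def sums_iff mult.commute)
qed

lemma cinner_add_left: "cinner (f + g) h = cinner f h + cinner g h"
  by (simp add: cinner_def hcoeff_simps distrib_right suminf_add cinner_summable)

lemma cinner_scaleH_left: "cinner (c *\<^sub>H f) g = c * cinner f g"
  by (simp add: cinner_def hcoeff_simps mult.assoc suminf_mult cinner_summable)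

instance
proof
  fix f g h :: hardy2 and r s :: real
  show "f + g + h = f + (g + h)" "f + g = g + f" "0 + f = f" "- f + f = 0" "f - g = f + - g"
    "r *\<^sub>R (f + g) = r *\<^sub>R f + r *\<^sub>R g" "(r + s) *\<^sub>R f = r *\<^sub>R f + s *\<^sub>R f"
    "r *\<^sub>R s *\<^sub>R f = (r * s) *\<^sub>R f" "1 *\<^sub>R f = f"
    by (rule hardy2_eqI; simp add: hcoeff_simps algebra_simps)+
  show "dist f g = norm (f - g)" by (rule dist_hardy2_def)
  show "sgn f = inverse (norm f) *\<^sub>R f" by (rule sgn_hardy2_def)
  show "uniformity = (INF e\<in>{0<..}. principal {(x, y :: hardy2). dist x y < e})"
    by (rule uniformity_hardy2_def)
  show "open U \<longleftrightarrow> (\<forall>x\<in>U. \<forall>\<^sub>F (x', y) in uniformity. x' = x \<longrightarrow> y \<in> U)" for U :: "hardy2 set"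
    by (rule open_hardy2_def)
  show "inner f g = inner g f"
    using cinner_commute[of f g] by (simp add: inner_hardy2_def)
  show "inner (f + g) h = inner f h + inner g h"
    by (simp add: inner_hardy2_def cinner_add_left)
  have "r *\<^sub>R f = complex_of_real r *\<^sub>H f" by (simp add: scaleR_hardy2_def scaleH_def)
  then show "inner (r *\<^sub>R f) g = r * inner f g"
    by (simp add: inner_hardy2_def cinner_scaleH_left)
  show "0 \<le> inner f f"
    by (simp add: inner_hardy2_def cinner_self suminf_nonneg square_summable_hcoeff)
  show "norm f = sqrt (inner f f)"
    by (simp add: inner_hardy2_def cinner_self norm_hardy2_def)
  show "inner f f = 0 \<longleftrightarrow> f = 0"
  proof
    assume "inner f f = 0"
    then have "\<forall>n. hcoeff f n = 0"
      by (simp add: inner_hardy2_def cinner_self suminf_eq_zero_iff square_summable_hcoeff)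
    then show "f = 0" by (intro hardy2_eqI) (simp add: hcoeff_simps)
  qed (simp add: inner_hardy2_def cinner_self hcoeff_simps)
qed

end

definition monomial :: "nat \<Rightarrow> hardy2" where
  "monomial n = on_disk (\<lambda>z. z ^ n)"

lemma hcoeff_monomial: "hcoeff (monomial n) k = (if k = n then 1 else 0)"
  unfolding monomial_def
proof (rule on_disk_power_series(2))
  show "square_summable (\<lambda>k. if k = n then 1 else 0)"
    by (rule summable_finite[of "{n}"]) auto
  show "(\<lambda>k. (if k = n then 1 else 0) * z ^ k) sums z ^ n" for z :: complex
    using sums_single[of n "\<lambda>k. z ^ k"] by (simp add: if_distrib[of "\<lambda>x. x * _"] cong: if_cong)
qed

lemma cinner_monomial: "cinner f (monomial n) = hcoeff f n"
  using sums_single[of n "hcoeff f"]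
  by (simp add: cinner_def hcoeff_monomial if_distrib[of "\<lambda>x. _ * x"] if_distrib[of cnj] sums_iff
      eq_commute cong: if_cong)


section \<open>Operators\<close>

text \<open>The library predicate \<open>bounded_linear\<close> expresses real linearity only.\<close>

definition bounded_clinear :: "(hardy2 \<Rightarrow> hardy2) \<Rightarrow> bool" where
  "bounded_clinear X \<longleftrightarrow> bounded_linear X \<and> (\<forall>c f. X (c *\<^sub>H f) = c *\<^sub>H X f)"

definition hadjoint :: "(hardy2 \<Rightarrow> hardy2) \<Rightarrow> (hardy2 \<Rightarrow> hardy2)" where
  "hadjoint T = (THE S. \<forall>f g. cinner (S f) g = cinner f (T g))"

definition backward_shift :: "hardy2 \<Rightarrow> hardy2" where
  "backward_shift f = on_disk (\<lambda>z. \<Sum>n. hcoeff f (Suc n) * z ^ n)"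

definition dilation :: "complex \<Rightarrow> hardy2 \<Rightarrow> hardy2" where
  "dilation l f = on_disk (\<lambda>z. hfun f (l * z))"

definition extended_eigenoperator :: "complex \<Rightarrow> (hardy2 \<Rightarrow> hardy2) \<Rightarrow> bool" where
  "extended_eigenoperator l X \<longleftrightarrow>
     bounded_clinear X \<and> X \<noteq> (\<lambda>f. 0) \<and>
     (\<forall>f. backward_shift (X f) = l *\<^sub>H X (backward_shift f))"

lemma hcoeff_backward_shift: "hcoeff (backward_shift f) n = hcoeff f (Suc n)"
  unfolding backward_shift_def
proof (rule on_disk_power_series(2))
  show "square_summable (\<lambda>n. hcoeff f (Suc n))"
    using square_summable_hcoeff[of f] by (subst summable_Suc_iff)
  then show "(\<lambda>n. hcoeff f (Suc n) * z ^ n) sums (\<Sum>n. hcoeff f (Suc n) * z ^ n)"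
    if "z \<in> unit_disk" for z
    using square_summable_power[OF that] by (intro summable_sums square_summable_imp_summable)
qed

lemma backward_shift_monomial:
  "backward_shift (monomial 0) = 0" "backward_shift (monomial (Suc n)) = monomial n"
  by (rule hardy2_eqI; simp add: hcoeff_backward_shift hcoeff_monomial hcoeff_simps)+

lemma hcoeff_dilation:
  assumes "cmod l \<le> 1"
  shows "hcoeff (dilation l f) n = l ^ n * hcoeff f n"
  unfolding dilation_def
proof (rule on_disk_power_series(2))
  show "square_summable (\<lambda>n. l ^ n * hcoeff f n)"
  proof (rule summable_comparison_test[OF _ square_summable_hcoeff[of f]], intro exI allI impI)
    fix n
    have "cmod l ^ n * cmod (hcoeff f n) \<le> 1 * cmod (hcoeff f n)"
      using assms by (intro mult_right_mono power_le_one) auto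
    then have "(cmod l ^ n * cmod (hcoeff f n))\<^sup>2 \<le> (cmod (hcoeff f n))\<^sup>2"
      by (intro power_mono) auto
    then show "norm ((cmod (l ^ n * hcoeff f n))\<^sup>2) \<le> (cmod (hcoeff f n))\<^sup>2"
      by (simp add: norm_mult norm_power)
  qed
  show "(\<lambda>n. l ^ n * hcoeff f n * z ^ n) sums hfun f (l * z)" if "z \<in> unit_disk" for z
  proof -
    have "cmod l * cmod z \<le> 1 * cmod z" using assms by (intro mult_right_mono) auto
    then have "l * z \<in> unit_disk" using that by (simp add: norm_mult)
    from hcoeff_sums[OF this, of f] show ?thesis
      by (simp add: power_mult_distrib mult_ac)
  qed
qed

lemma dilation_monomial: "cmod l \<le> 1 \<Longrightarrow> dilation l (monomial n) = (l ^ n) *\<^sub>H monomial n"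
  by (rule hardy2_eqI) (simp add: hcoeff_dilation hcoeff_monomial hcoeff_simps)


subsection \<open>The operators \<open>\<phi>(B)\<close> and \<open>R\<^sub>\<lambda> \<phi>(B)\<close>\<close>

definition Hinf :: "(complex \<Rightarrow> complex) set" where
  "Hinf = {\<phi>. \<phi> holomorphic_on unit_disk \<and> bounded (\<phi> ` unit_disk)}"

definition mult_op :: "(complex \<Rightarrow> complex) \<Rightarrow> hardy2 \<Rightarrow> hardy2" where
  "mult_op \<phi> f = on_disk (\<lambda>z. \<phi> z * hfun f z)"

definition phi_B :: "(complex \<Rightarrow> complex) \<Rightarrow> hardy2 \<Rightarrow> hardy2" where
  "phi_B \<phi> = hadjoint (mult_op (\<lambda>z. cnj (\<phi> (cnj z))))"

text \<open>For \<open>\<phi>\<close> in the Hardy space and \<open>\<bar>l\<bar> < 1\<close>, the symbol \<open>R\<^sub>l \<phi>(B)\<close> is not a composition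
  of two bounded operators: it stands for the bounded operator with prescribed values on the
  monomials, where \<open>0 ^ 0 = 1\<close>.\<close>

definition is_dilation_phi_B :: "complex \<Rightarrow> hardy2 \<Rightarrow> (hardy2 \<Rightarrow> hardy2) \<Rightarrow> bool" where
  "is_dilation_phi_B l \<phi> T \<longleftrightarrow>
     bounded_clinear T \<and>
     (\<forall>n. T (monomial n) = (\<Sum>k\<le>n. (hcoeff \<phi> k * l ^ (n - k)) *\<^sub>H monomial (n - k)))"

definition dilation_phi_B :: "complex \<Rightarrow> hardy2 \<Rightarrow> hardy2 \<Rightarrow> hardy2" where
  "dilation_phi_B l \<phi> = (THE T. is_dilation_phi_B l \<phi> T)"

end

theory Submission
  imports Defs
begin

text \<open>
  If \<open>B X = l X B\<close>, then the \<open>m\<close>-th coefficient of \<open>X f\<close> is \<open>l\<^sup>m\<close> times the constant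
  coefficient of \<open>X B\<^sup>m f\<close>. By the Riesz representation of the bounded functional
  \<open>f \<mapsto> (X f) 0\<close>, this equals \<open>l\<^sup>m \<Sum>\<^sub>k c\<^sub>k f\<^sub>k\<^sub>+\<^sub>m\<close> for a square summable symbol \<open>c\<close>.
  For \<open>\<bar>l\<bar> < 1\<close> the factors \<open>l\<^sup>m\<close> make every such symbol admissible. For \<open>\<bar>l\<bar> = 1\<close>, testing
  \<open>X\<close> on the kernel functions \<open>\<Sum>\<^sub>n w\<^sup>n z\<^sup>n\<close> shows that the symbol is a bounded function.
\<close>

section \<open>Coefficients of dominated power series\<close>

text \<open>Discrete Parseval identity: for \<open>n < N\<close> the vectors
  \<open>j \<mapsto> (w ^ j) ^ n\<close> are orthogonal on the \<open>N\<close>-th roots of unity.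
  Finite averages thus take the place of integrals over a circle.\<close>

lemma root_of_unity_parseval:
  fixes a :: "nat \<Rightarrow> complex"
  assumes "N > 0"
  defines "w \<equiv> exp (2 * of_real pi * \<i> / of_nat N)"
  shows "(\<Sum>j<N. (cmod (\<Sum>n<N. a n * (w ^ j) ^ n))\<^sup>2) = of_nat N * (\<Sum>n<N. (cmod (a n))\<^sup>2)"
proof -
  have w_power: "w ^ k = exp (2 * of_real pi * \<i> * of_nat k / of_nat N)" for k
    unfolding w_def exp_of_nat_mult[symmetric] by (simp add: mult_ac)
  have norm_w: "cmod w = 1"
    unfolding w_def by (simp add: norm_exp_eq_Re)
  have w_N: "w ^ N = 1"
    unfolding w_power using assms(1) by simp
  have inj: "w ^ n \<noteq> w ^ m" if "n < N" "m < N" "n \<noteq> m" for n m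
    unfolding w_power using complex_root_unity_eq[of N n m] that by simp
  have orth: "(\<Sum>j<N. (w ^ j) ^ n * cnj ((w ^ j) ^ m)) = (if n = m then of_nat N else 0)"
    if nm: "n < N" "m < N" for n m
  proof -
    \<comment> \<open>The sum over \<open>j\<close> is geometric with ratio \<open>q\<close>. Always
      \<open>q ^ N = 1\<close>, and \<open>q = 1\<close> only if \<open>w ^ n = w ^ m\<close>, so
      off the diagonal it vanishes.\<close>
    define q where "q = w ^ n * cnj (w ^ m)"
    have w_cnj: "w ^ m * cnj (w ^ m) = 1"
      by (metis complex_norm_square norm_power norm_w of_real_1 power_one)
    have q_power: "(w ^ j) ^ n * cnj ((w ^ j) ^ m) = q ^ j" for j
      unfolding q_def power_mult_distrib complex_cnj_power
      by (simp add: power_mult[symmetric] mult.commute)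
    show ?thesis
    proof (cases "n = m")
      case True
      then have "q = 1" using w_cnj by (simp add: q_def)
      then show ?thesis unfolding q_power using True by simp
    next
      case False
      have "q \<noteq> 1"
      proof
        assume "q = 1"
        then have "w ^ n * (w ^ m * cnj (w ^ m)) = w ^ m"
          unfolding q_def by (metis mult.left_commute mult_1_right)
        then show False using inj[OF nm False] unfolding w_cnj by simp
      qed
      moreover have "q ^ N = 1"
      proof -
        have "q ^ N = (w ^ N) ^ n * cnj ((w ^ N) ^ m)"
          using q_power[of N] by simp
        then show ?thesis by (simp add: w_N)
      qed
      ultimately show ?thesis
        using False by (simp only: q_power) (simp add: sum_gp_strict)
    qed
  qed
  have "complex_of_real (\<Sum>j<N. (cmod (\<Sum>n<N. a n * (w ^ j) ^ n))\<^sup>2)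
      = (\<Sum>j<N. (\<Sum>n<N. a n * (w ^ j) ^ n) * cnj (\<Sum>n<N. a n * (w ^ j) ^ n))"
    by (simp only: of_real_sum complex_norm_square)
  also have "\<dots> = (\<Sum>j<N. \<Sum>n<N. \<Sum>m<N. a n * cnj (a m) * ((w ^ j) ^ n * cnj ((w ^ j) ^ m)))"
    by (simp add: sum_product mult_ac)
  also have "\<dots> = (\<Sum>n<N. \<Sum>j<N. \<Sum>m<N. a n * cnj (a m) * ((w ^ j) ^ n * cnj ((w ^ j) ^ m)))"
    by (rule sum.swap)
  also have "\<dots> = (\<Sum>n<N. \<Sum>m<N. \<Sum>j<N. a n * cnj (a m) * ((w ^ j) ^ n * cnj ((w ^ j) ^ m)))"
    by (intro sum.cong refl sum.swap)
  also have "\<dots> = (\<Sum>n<N. \<Sum>m<N. a n * cnj (a m) * (if n = m then of_nat N else 0))"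
    by (intro sum.cong refl) (simp only: sum_distrib_left[symmetric] orth lessThan_iff)
  also have "\<dots> = (\<Sum>n<N. of_nat N * (a n * cnj (a n)))"
    by (intro sum.cong refl) (simp add: if_distrib[of "\<lambda>x. _ * x"] mult_ac cong: if_cong)
  also have "\<dots> = complex_of_real (of_nat N * (\<Sum>n<N. (cmod (a n))\<^sup>2))"
    by (simp add: sum_distrib_left complex_norm_square[symmetric])
  finally show ?thesis
    using of_real_eq_iff by blast
qed

text \<open>The Weierstrass test gives uniform convergence on a circle strictly inside the disk;
  squaring preserves it because the limit is bounded there.\<close>

lemma uniform_limit_power_series_norm_sq:
  fixes a :: "nat \<Rightarrow> complex"
  assumes sums: "\<And>z. z \<in> unit_disk \<Longrightarrow> (\<lambda>n. a n * z ^ n) sums f z"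
    and r: "0 \<le> r" "r < 1"
  shows "uniform_limit (sphere 0 r) (\<lambda>N z. (cmod (\<Sum>n<N. a n * z ^ n))\<^sup>2)
    (\<lambda>z. (cmod (f z))\<^sup>2) sequentially"
proof -
  have abs: "summable (\<lambda>n. cmod (a n) * r ^ n)"
  proof -
    \<comment> \<open>The midpoint of \<open>r\<close> and 1 is a point of convergence beyond
      \<open>r\<close>, which makes the series absolutely convergent at \<open>r\<close>.\<close>
    have "summable (\<lambda>n. a n * of_real ((1 + r) / 2) ^ n)"
      using sums[of "of_real ((1 + r) / 2)"] r
      by (simp add: sums_iff del: of_real_add of_real_divide)
    from powser_insidea[OF this, of "of_real r"] show ?thesis
      using r by (simp add: norm_mult norm_power del: of_real_add of_real_divide)
  qed
  have f_eq: "f z = (\<Sum>n. a n * z ^ n)" if "z \<in> sphere 0 r" for z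
    using sums[of z] that r by (simp add: sums_iff)
  have "uniform_limit (sphere 0 r) (\<lambda>N z. \<Sum>n<N. a n * z ^ n) (\<lambda>z. \<Sum>n. a n * z ^ n) sequentially"
    by (rule Weierstrass_m_test[OF _ abs]) (auto simp: norm_mult norm_power)
  then have lim: "uniform_limit (sphere 0 r) (\<lambda>N z. \<Sum>n<N. a n * z ^ n) f sequentially"
    by (rule uniform_limit_cong'[THEN iffD1, rotated 2]) (simp_all add: f_eq)
  have "cmod (f z) \<le> (\<Sum>n. cmod (a n) * r ^ n)" if "z \<in> sphere 0 r" for z
  proof -
    have eq: "cmod (a n * z ^ n) = cmod (a n) * r ^ n" for n
      using that by (simp add: norm_mult norm_power)
    show ?thesis
      using summable_norm[of "\<lambda>n. a n * z ^ n"] abs by (simp only: f_eq[OF that] eq)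
  qed
  then have bdd: "bounded ((\<lambda>z. cmod (f z)) ` sphere 0 r)"
    unfolding bounded_iff by force
  show ?thesis
    unfolding power2_eq_square
    by (intro uniform_lim_mult uniform_limit_norm lim bdd)
qed

text \<open>The inequality between the power series turns into one between their partial sums, up to an
  error that is uniform on a circle of radius \<open>r < 1\<close>; averaging over the roots of unity then gives
  the bound with \<open>b n * r ^ n\<close> in place of \<open>b n\<close>.\<close>

lemma dominated_power_series_coeff_bound:
  fixes a b :: "nat \<Rightarrow> complex"
  assumes f: "\<And>z. z \<in> unit_disk \<Longrightarrow> (\<lambda>n. a n * z ^ n) sums f z"
    and g: "\<And>z. z \<in> unit_disk \<Longrightarrow> (\<lambda>n. b n * z ^ n) sums g z"
    and le: "\<And>z. z \<in> unit_disk \<Longrightarrow> cmod (g z) \<le> M * cmod (f z)"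
    and a: "square_summable a"
  shows "(\<Sum>n<K. (cmod (b n))\<^sup>2) \<le> M\<^sup>2 * (\<Sum>n. (cmod (a n))\<^sup>2)"
proof -
  let ?S = "\<Sum>n. (cmod (a n))\<^sup>2"
  have circle: "(\<Sum>n<K. (cmod (b n) * r ^ n)\<^sup>2) \<le> M\<^sup>2 * ?S + d"
    if r: "0 < r" "r < 1" and d: "0 < d" for r d :: real
  proof -
    let ?D = "\<lambda>N z. (cmod (\<Sum>n<N. b n * z ^ n))\<^sup>2 - M\<^sup>2 * (cmod (\<Sum>n<N. a n * z ^ n))\<^sup>2"
    have "uniform_limit (sphere 0 r) ?D
        (\<lambda>z. (cmod (g z))\<^sup>2 - M\<^sup>2 * (cmod (f z))\<^sup>2) sequentially"
      using r f g
      by (intro uniform_limit_minus uniform_limit_power_series_norm_sq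
          bounded_linear.uniform_limit[OF bounded_linear_mult_right]) auto
    \<comment> \<open>\<open>N \<ge> Suc K\<close> secures both \<open>N > 0\<close>, for the roots
      of unity, and \<open>K \<le> N\<close>, for comparing partial sums.\<close>
    from uniform_limitD[OF this d] have "\<forall>\<^sub>F N in sequentially. (\<forall>z\<in>sphere 0 r. 
        dist (?D N z) ((cmod (g z))\<^sup>2 - M\<^sup>2 * (cmod (f z))\<^sup>2) < d) \<and> N \<ge> Suc K"
      by (intro eventually_conj eventually_ge_at_top)
    then obtain N where N: "N \<ge> Suc K" and
      D: "\<And>z. z \<in> sphere 0 r \<Longrightarrow> dist (?D N z) ((cmod (g z))\<^sup>2 - M\<^sup>2 * (cmod (f z))\<^sup>2) < d"
      using eventually_happens'[OF sequentially_bot] by fastforce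
    have pt: "(cmod (\<Sum>n<N. b n * z ^ n))\<^sup>2 \<le> M\<^sup>2 * (cmod (\<Sum>n<N. a n * z ^ n))\<^sup>2 + d"
      if z: "z \<in> sphere 0 r" for z
    proof -
      have "(cmod (g z))\<^sup>2 \<le> (M * cmod (f z))\<^sup>2"
        using le[of z] z r by (intro power_mono) auto
      then show ?thesis
        using D[OF z] by (simp add: dist_real_def power_mult_distrib abs_less_iff)
    qed
    define w where "w = exp (2 * of_real pi * \<i> / of_nat N)"
    have norm_w: "cmod w = 1"
      unfolding w_def by (simp add: norm_exp_eq_Re)
    have N0: "N > 0" using N by simp
    \<comment> \<open>Absorbing \<open>r ^ n\<close> into the coefficients moves the sample points
      to the circle of radius \<open>r\<close>, where \<open>pt\<close> applies.\<close>
    have parseval: "(\<Sum>j<N. (cmod (\<Sum>n<N. c n * (of_real r * w ^ j) ^ n))\<^sup>2)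
        = N * (\<Sum>n<N. (cmod (c n) * r ^ n)\<^sup>2)" for c
      using root_of_unity_parseval[OF N0, of "\<lambda>n. c n * of_real r ^ n", folded w_def] r
      by (simp add: power_mult_distrib norm_mult norm_power mult_ac)
    \<comment> \<open>Over the \<open>N\<close> sample points the errors add up to
      \<open>N * d\<close>; dividing by the Parseval factor \<open>N\<close> leaves
      \<open>d\<close>.\<close>
    have "N * (\<Sum>n<N. (cmod (b n) * r ^ n)\<^sup>2)
        \<le> (\<Sum>j<N. M\<^sup>2 * (cmod (\<Sum>n<N. a n * (of_real r * w ^ j) ^ n))\<^sup>2 + d)"
      unfolding parseval[symmetric]
      using r by (intro sum_mono pt) (simp add: norm_mult norm_power norm_w)
    also have "\<dots> = N * (M\<^sup>2 * (\<Sum>n<N. (cmod (a n) * r ^ n)\<^sup>2) + d)"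
      by (simp only: sum.distrib sum_distrib_left[symmetric] parseval) (simp add: algebra_simps)
    finally have *: "(\<Sum>n<N. (cmod (b n) * r ^ n)\<^sup>2) \<le> M\<^sup>2 * (\<Sum>n<N. (cmod (a n) * r ^ n)\<^sup>2) + d"
      using N0 by simp
    have "(\<Sum>n<N. (cmod (a n) * r ^ n)\<^sup>2) \<le> (\<Sum>n<N. (cmod (a n))\<^sup>2)"
      using r by (intro sum_mono power_mono mult_left_le power_le_one) auto
    also have "\<dots> \<le> ?S"
      using a by (intro sum_le_suminf) auto
    finally have "M\<^sup>2 * (\<Sum>n<N. (cmod (a n) * r ^ n)\<^sup>2) \<le> M\<^sup>2 * ?S"
      by (intro mult_left_mono) auto
    moreover have "(\<Sum>n<K. (cmod (b n) * r ^ n)\<^sup>2) \<le> (\<Sum>n<N. (cmod (b n) * r ^ n)\<^sup>2)"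
      using N by (intro sum_mono2) auto
    ultimately show ?thesis using * by linarith
  qed
  \<comment> \<open>First \<open>d\<close> tends to 0 at fixed \<open>r\<close>, then
    \<open>r\<close> to 1. With \<open>K\<close> fixed only a finite sum passes to the
    limit.\<close>
  have "((\<lambda>r. \<Sum>n<K. (cmod (b n) * r ^ n)\<^sup>2) \<longlongrightarrow> (\<Sum>n<K. (cmod (b n) * 1 ^ n)\<^sup>2)) (at_left 1)"
    by (intro tendsto_intros)
  moreover have "\<forall>\<^sub>F r in at_left 1. (\<Sum>n<K. (cmod (b n) * r ^ n)\<^sup>2) \<le> M\<^sup>2 * ?S"
  proof -
    have "\<forall>\<^sub>F r in at_left 1. r \<in> {0<..<(1::real)}"
      by (intro eventually_at_left_real) simp
    then show ?thesis
      by eventually_elim (rule field_le_epsilon, rule circle, auto)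
  qed
  ultimately have "(\<Sum>n<K. (cmod (b n) * 1 ^ n)\<^sup>2) \<le> M\<^sup>2 * ?S"
    by (rule tendsto_upperbound) simp
  then show ?thesis by simp
qed

section \<open>Hilbert space facts\<close>

text \<open>Powers of a point of the disk are square summable, so the power series converges there
  by comparison; elements may therefore be given by their coefficients.\<close>

lemma hardy2_of_hcoeff:
  assumes "square_summable a"
  shows "\<exists>f. \<forall>n. hcoeff f n = a n"
proof (intro exI allI)
  fix n
  show "hcoeff (on_disk (\<lambda>z. \<Sum>n. a n * z ^ n)) n = a n"
    using assms by (intro on_disk_power_series(2) summable_sums square_summable_imp_summable
        square_summable_power) auto
qed

lemma hcoeff_sum: "hcoeff (sum F A) n = (\<Sum>i\<in>A. hcoeff (F i) n)"
  by (induction A rule: infinite_finite_induct) (simp_all add: hcoeff_simps)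

lemma norm_sq_hardy2: "(norm f)\<^sup>2 = (\<Sum>n. (cmod (hcoeff f n))\<^sup>2)" for f :: hardy2
  by (simp add: norm_hardy2_def suminf_nonneg square_summable_hcoeff)

lemma norm_hcoeff_le: "cmod (hcoeff f n) \<le> norm f"
proof (rule power2_le_imp_le)
  show "(cmod (hcoeff f n))\<^sup>2 \<le> (norm f)\<^sup>2"
    unfolding norm_sq_hardy2
    using sum_le_suminf[OF square_summable_hcoeff, of "{n}" f] by simp
qed simp

lemma bounded_linear_hcoeff: "bounded_linear (\<lambda>f. hcoeff f n)"
  by (rule bounded_linear_intro[of _ 1])
    (simp_all add: hcoeff_simps norm_hcoeff_le scaleR_conv_of_real)

lemma scaleR_eq_scaleH: "r *\<^sub>R f = complex_of_real r *\<^sub>H f"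
  by (rule hardy2_eqI) (simp add: hcoeff_simps)

lemma norm_scaleH: "norm (c *\<^sub>H f) = cmod c * norm f"
proof (rule power2_eq_imp_eq)
  show "(norm (c *\<^sub>H f))\<^sup>2 = (cmod c * norm f)\<^sup>2"
    unfolding norm_sq_hardy2 power_mult_distrib
    by (simp add: hcoeff_simps norm_mult power_mult_distrib suminf_mult square_summable_hcoeff)
qed simp_all

text \<open>The real Cauchy-Schwarz inequality applies once \<open>f\<close> is multiplied by a
  unimodular constant that makes the pairing real and nonnegative.\<close>

lemma norm_cinner_le: "cmod (cinner f g) \<le> norm f * norm g"
proof (cases "cinner f g = 0")
  case False
  define c where "c = cnj (sgn (cinner f g))"
  have "cmod (cinner f g) = Re (cinner (c *\<^sub>H f) g)"
  proof -
    have "sgn z * cnj (sgn z) = 1" if "z \<noteq> 0" for z :: complex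
      using that by (metis complex_norm_square norm_sgn of_real_1 power_one)
    then have "c * cinner f g = complex_of_real (cmod (cinner f g))"
      using False by (simp add: c_def sgn_eq field_simps complex_norm_square[symmetric] power2_eq_square)
    then show ?thesis by (simp add: cinner_scaleH_left)
  qed
  also have "\<dots> = inner (c *\<^sub>H f) g" by (simp add: inner_hardy2_def)
  also have "\<dots> \<le> norm (c *\<^sub>H f) * norm g" by (rule norm_cauchy_schwarz)
  also have "norm (c *\<^sub>H f) = norm f"
    using False by (simp add: norm_scaleH c_def norm_sgn)
  finally show ?thesis .
qed simp

lemma bounded_linear_cinner_left: "bounded_linear (\<lambda>f. cinner f g)"
proof (rule bounded_linear_intro)
  show "cmod (cinner f g) \<le> norm f * norm g" for f by (rule norm_cinner_le)
qed (simp_all add: cinner_add_left scaleR_eq_scaleH cinner_scaleH_left scaleR_conv_of_real)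

section \<open>Monomial expansions, bounded functionals and adjoints\<close>

text \<open>The squared error of a partial sum is a tail of the convergent series of squared
  coefficients.\<close>

lemma monomial_expansion: "(\<lambda>n. hcoeff f n *\<^sub>H monomial n) sums f"
proof -
  let ?p = "\<lambda>N. \<Sum>n<N. hcoeff f n *\<^sub>H monomial n"
  let ?a = "\<lambda>n. (cmod (hcoeff f n))\<^sup>2"
  have coeff: "hcoeff (f - ?p N) n = (if n < N then 0 else hcoeff f n)" for N n
    by (simp add: hcoeff_simps hcoeff_sum hcoeff_monomial if_distrib[of "\<lambda>x. _ * x"] cong: if_cong)
  have "(norm (f - ?p N))\<^sup>2 = suminf ?a - sum ?a {..<N}" for N
  proof -
    have "(norm (f - ?p N))\<^sup>2 = (\<Sum>n. if n < N then 0 else ?a n)"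
      unfolding norm_sq_hardy2 coeff by (intro suminf_cong) simp
    also have "\<dots> = (\<Sum>n. ?a n - (if n \<in> {..<N} then ?a n else 0))"
      by (intro suminf_cong) simp
    also have "\<dots> = suminf ?a - sum ?a {..<N}"
      using sums_diff[OF summable_sums[OF square_summable_hcoeff[of f]]
          sums_If_finite_set[of "{..<N}" ?a]] by (simp add: sums_iff)
    finally show ?thesis .
  qed
  moreover have "(\<lambda>N. suminf ?a - sum ?a {..<N}) \<longlonglongrightarrow> suminf ?a - suminf ?a"
    by (intro tendsto_intros summable_LIMSEQ square_summable_hcoeff)
  ultimately have "(\<lambda>N. sqrt ((norm (f - ?p N))\<^sup>2)) \<longlonglongrightarrow> sqrt 0"
    by (intro tendsto_real_sqrt) simp
  then have "(\<lambda>N. norm (?p N - f)) \<longlonglongrightarrow> 0"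
    by (simp add: norm_minus_commute)
  then show ?thesis
    unfolding sums_def by (rule LIM_zero_cancel[OF tendsto_norm_zero_cancel])
qed

lemma functional_monomial_expansion:
  fixes L :: "hardy2 \<Rightarrow> complex"
  assumes L: "bounded_linear L" and clin: "\<And>c f. L (c *\<^sub>H f) = c * L f"
  shows "(\<lambda>n. L (monomial n) * hcoeff f n) sums L f"
  using bounded_linear.sums[OF L monomial_expansion[of f]] by (simp add: clin mult.commute)

text \<open>The substantial half of Riesz representation. Tested on the truncation \<open>g\<close>
  with coefficients \<open>cnj (L (monomial n))\<close>, the functional takes the value
  \<open>(norm g)\<^sup>2\<close>, which boundedness limits to \<open>norm g * C\<close>.\<close>

lemma functional_square_summable:
  fixes L :: "hardy2 \<Rightarrow> complex"
  assumes L: "bounded_linear L" and clin: "\<And>c f. L (c *\<^sub>H f) = c * L f"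
  shows "square_summable (\<lambda>n. L (monomial n))"
proof -
  obtain C where C: "\<And>f. cmod (L f) \<le> norm f * C"
    using bounded_linear.bounded[OF L] by blast
  have "(\<Sum>n<N. (cmod (L (monomial n)))\<^sup>2) \<le> C\<^sup>2" for N
  proof -
    let ?s = "\<Sum>n<N. (cmod (L (monomial n)))\<^sup>2"
    define g where "g = (\<Sum>n<N. cnj (L (monomial n)) *\<^sub>H monomial n)"
    have coeff: "hcoeff g n = (if n < N then cnj (L (monomial n)) else 0)" for n
      by (simp add: g_def hcoeff_simps hcoeff_sum hcoeff_monomial if_distrib[of "\<lambda>x. _ * x"] cong: if_cong)
    have "(norm g)\<^sup>2 = (\<Sum>n. if n \<in> {..<N} then (cmod (L (monomial n)))\<^sup>2 else 0)"
      unfolding norm_sq_hardy2 coeff by (intro suminf_cong) simp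
    then have norm_g: "(norm g)\<^sup>2 = ?s"
      using sums_If_finite_set[of "{..<N}" "\<lambda>n. (cmod (L (monomial n)))\<^sup>2"] by (simp add: sums_iff)
    have "L g = of_real ?s"
      unfolding g_def linear_sum[OF bounded_linear.linear[OF L]] clin
      by (simp add: complex_norm_square[symmetric] mult.commute)
    then have "?s \<le> norm g * C"
      using C[of g] by (simp add: sum_nonneg del: of_real_sum)
    then have "norm g * norm g \<le> norm g * C"
      using norm_g by (simp add: power2_eq_square)
    \<comment> \<open>\<open>C\<close> comes without a sign, hence the absolute value, which
      squaring removes.\<close>
    then have "norm g \<le> \<bar>C\<bar>"
      by (cases "norm g = 0") auto
    then show ?thesis
      using norm_g by (metis abs_ge_zero norm_ge_zero power2_abs power_mono)
  qed
  then show ?thesis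
    by (intro summableI_nonneg_bounded) auto
qed

lemma bounded_clinear_eqI:
  assumes X: "bounded_clinear X" and Y: "bounded_clinear Y"
    and eq: "\<And>n. X (monomial n) = Y (monomial n)"
  shows "X = Y"
proof
  fix f
  have "(\<lambda>n. hcoeff f n *\<^sub>H Z (monomial n)) sums Z f" if "bounded_clinear Z" for Z
    using bounded_linear.sums[OF _ monomial_expansion, of Z f] that
    by (simp add: bounded_clinear_def)
  from this[OF X] this[OF Y] show "X f = Y f"
    unfolding eq by (rule sums_unique2)
qed

text \<open>\<open>hadjoint\<close> is a definite description. Existence is Riesz representation of
  \<open>g \<mapsto> cinner (T g) f\<close>, which is linear, with conjugated values as
  coefficients; uniqueness holds because pairing with monomials reads off every coefficient.\<close>

lemma hadjoint_cinner:
  assumes T: "bounded_clinear T"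
  shows "cinner (hadjoint T f) g = cinner f (T g)"
proof -
  have "\<exists>h. \<forall>g. cinner h g = cinner f (T g)" for f
  proof -
    have L: "bounded_linear (\<lambda>g. cinner (T g) f)"
      using T by (intro bounded_linear_compose[OF bounded_linear_cinner_left])
        (simp add: bounded_clinear_def)
    have clin: "cinner (T (c *\<^sub>H g)) f = c * cinner (T g) f" for c g
      using T by (simp add: bounded_clinear_def cinner_scaleH_left)
    have "square_summable (\<lambda>n. cnj (cinner (T (monomial n)) f))"
      using functional_square_summable[OF L clin] by simp
    then obtain h where h: "\<And>n. hcoeff h n = cnj (cinner (T (monomial n)) f)"
      using hardy2_of_hcoeff[of "\<lambda>n. cnj (cinner (T (monomial n)) f)"] by blast
    have "cinner h g = cinner f (T g)" for g
    proof -
      have "cinner g h = cinner (T g) f"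
        using functional_monomial_expansion[OF L clin, of g]
        by (simp add: cinner_def[of g h] h sums_iff mult.commute)
      then show ?thesis by (metis cinner_commute)
    qed
    then show ?thesis by blast
  qed
  then obtain S where S: "\<forall>f g. cinner (S f) g = cinner f (T g)"
    by metis
  have "hadjoint T = S"
    unfolding hadjoint_def
  proof (rule the_equality)
    fix S' assume "\<forall>f g. cinner (S' f) g = cinner f (T g)"
    then have "cinner (S' f) (monomial n) = cinner (S f) (monomial n)" for f n
      using S by simp
    then show "S' = S"
      by (intro ext hardy2_eqI) (simp add: cinner_monomial)
  qed (rule S)
  then show ?thesis using S by simp
qed

section \<open>Operators with a symbol\<close>

text \<open>The coefficient form of \<open>R\<^sub>l \<phi>(B)\<close>: a Toeplitz matrix with row
  \<open>m\<close> scaled by \<open>l ^ m\<close>. It is meaningful for every square summable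
  symbol, so it serves both ranges of |l|.\<close>

definition has_symbol :: "complex \<Rightarrow> hardy2 \<Rightarrow> (hardy2 \<Rightarrow> hardy2) \<Rightarrow> bool" where
  "has_symbol l \<phi> X \<longleftrightarrow>
    (\<forall>f m. hcoeff (X f) m = l ^ m * (\<Sum>k. hcoeff \<phi> k * hcoeff f (k + m)))"

lemma has_symbolD:
  "has_symbol l \<phi> X \<Longrightarrow> hcoeff (X f) m = l ^ m * (\<Sum>k. hcoeff \<phi> k * hcoeff f (k + m))"
  by (simp add: has_symbol_def)

lemma has_symbol_unique: "has_symbol l \<phi> X \<Longrightarrow> has_symbol l \<phi> Y \<Longrightarrow> X = Y"
  by (intro ext hardy2_eqI) (simp add: has_symbol_def)

lemma hcoeff_backward_shift_funpow: "hcoeff ((backward_shift ^^ m) f) n = hcoeff f (n + m)"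
  by (induction m arbitrary: n) (simp_all add: hcoeff_backward_shift)

lemma has_symbol_monomial:
  assumes "has_symbol l \<phi> X"
  shows "hcoeff (X (monomial n)) m = (if m \<le> n then l ^ m * hcoeff \<phi> (n - m) else 0)"
proof -
  \<comment> \<open>Only \<open>k = n - m\<close> survives. For \<open>m > n\<close> truncated
    subtraction would select \<open>k = 0\<close>; the inner conditional makes that term 0.\<close>
  have "(\<Sum>k. hcoeff \<phi> k * hcoeff (monomial n) (k + m))
      = (\<Sum>k. if k = n - m then (if m \<le> n then hcoeff \<phi> (n - m) else 0) else 0)"
    by (intro suminf_cong) (auto simp: hcoeff_monomial)
  then show ?thesis
    using sums_single[of "n - m" "\<lambda>k. if m \<le> n then hcoeff \<phi> (n - m) else 0"]
    by (simp add: has_symbolD[OF assms] sums_iff)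
qed

text \<open>Raising \<open>m\<close> by one yields one factor \<open>l\<close> and one shift of
  \<open>f\<close>, which is the intertwining relation. Row \<open>m = 0\<close> carries the factor
  \<open>l ^ 0 = 1\<close>, even for \<open>l = 0\<close>, so the operator determines its
  symbol.\<close>

lemma has_symbol_extended_eigenoperator_iff:
  assumes X: "bounded_clinear X" and sym: "has_symbol l \<phi> X"
  shows "extended_eigenoperator l X \<longleftrightarrow> \<phi> \<noteq> 0"
proof -
  have "backward_shift (X f) = l *\<^sub>H X (backward_shift f)" for f
    by (rule hardy2_eqI) (simp add: hcoeff_backward_shift hcoeff_simps has_symbolD[OF sym])
  moreover have "X = (\<lambda>f. 0) \<longleftrightarrow> \<phi> = 0"
  proof
    assume X0: "X = (\<lambda>f. 0)"
    have "hcoeff \<phi> n = 0" for n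
      using has_symbol_monomial[OF sym, of n 0] by (simp add: X0 hcoeff_simps)
    then show "\<phi> = 0" by (intro hardy2_eqI) (simp add: hcoeff_simps)
  next
    assume "\<phi> = 0"
    then show "X = (\<lambda>f. 0)"
      by (intro ext hardy2_eqI) (simp add: hcoeff_simps has_symbolD[OF sym])
  qed
  ultimately show ?thesis
    using X by (simp add: extended_eigenoperator_def)
qed

lemma extended_eigenoperator_has_symbol:
  assumes "extended_eigenoperator l X"
  obtains \<phi> where "has_symbol l \<phi> X"
proof -
  have bdd: "bounded_linear X" and clin: "\<And>c f. X (c *\<^sub>H f) = c *\<^sub>H X f"
    and eig: "\<And>f. backward_shift (X f) = l *\<^sub>H X (backward_shift f)"
    using assms by (auto simp: extended_eigenoperator_def bounded_clinear_def)
  have L: "bounded_linear (\<lambda>f. hcoeff (X f) 0)"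
    by (rule bounded_linear_compose[OF bounded_linear_hcoeff bdd])
  have L_clin: "hcoeff (X (c *\<^sub>H f)) 0 = c * hcoeff (X f) 0" for c f
    by (simp add: clin hcoeff_simps)
  obtain \<phi> where \<phi>: "\<And>n. hcoeff \<phi> n = hcoeff (X (monomial n)) 0"
    using hardy2_of_hcoeff[OF functional_square_summable[OF L L_clin]] by blast
  \<comment> \<open>Coefficient \<open>Suc m\<close> of \<open>X f\<close> is coefficient
    \<open>m\<close> of \<open>B X f = l X B f\<close>; the induction therefore needs arbitrary
    \<open>f\<close>.\<close>
  have shift: "hcoeff (X f) m = l ^ m * hcoeff (X ((backward_shift ^^ m) f)) 0" for f m
  proof (induction m arbitrary: f)
    case (Suc m)
    have "hcoeff (X f) (Suc m) = l * hcoeff (X (backward_shift f)) m"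
      by (metis eig hcoeff_backward_shift hcoeff_scaleH)
    then show ?case
      by (simp add: Suc.IH funpow_Suc_right del: funpow.simps)
  qed simp
  have "has_symbol l \<phi> X"
    unfolding has_symbol_def
  proof (intro allI)
    fix f m
    show "hcoeff (X f) m = l ^ m * (\<Sum>k. hcoeff \<phi> k * hcoeff f (k + m))"
      using functional_monomial_expansion[OF L L_clin, of "(backward_shift ^^ m) f"]
      by (simp add: shift[of f m] \<phi> hcoeff_backward_shift_funpow sums_iff)
  qed
  then show ?thesis by (rule that)
qed

section \<open>The case of modulus one\<close>

lemma HinfE:
  assumes "\<phi> \<in> Hinf"
  obtains M where "\<phi> holomorphic_on unit_disk" "0 \<le> M" "\<And>z. z \<in> unit_disk \<Longrightarrow> cmod (\<phi> z) \<le> M"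
proof -
  obtain M where "\<forall>z\<in>unit_disk. cmod (\<phi> z) \<le> M"
    using assms by (auto simp: Hinf_def bounded_iff)
  moreover from this have "0 \<le> M"
    using norm_ge_zero order_trans by (metis centre_in_ball zero_less_one)
  ultimately show ?thesis
    using that assms by (auto simp: Hinf_def)
qed

text \<open>The product has the Cauchy product as coefficients. The pointwise bound by
  \<open>M\<close> passes to coefficient norms through the domination lemma, which gives both
  membership in the Hardy space and the operator bound.\<close>

lemma mult_op_Hinf:
  assumes "\<psi> \<in> Hinf"
  shows hcoeff_mult_op: "hcoeff (mult_op \<psi> f) n = (\<Sum>i\<le>n. taylor_coeff \<psi> i * hcoeff f (n - i))"
    and bounded_clinear_mult_op: "bounded_clinear (mult_op \<psi>)"
proof -
  obtain M where hol: "\<psi> holomorphic_on unit_disk" and M: "0 \<le> M"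
    and le: "\<And>z. z \<in> unit_disk \<Longrightarrow> cmod (\<psi> z) \<le> M"
    using HinfE[OF assms] by blast
  let ?b = "\<lambda>f n. \<Sum>i\<le>n. taylor_coeff \<psi> i * hcoeff f (n - i)"
  have sums: "(\<lambda>n. ?b f n * z ^ n) sums (\<psi> z * hfun f z)" if z: "z \<in> unit_disk" for f z
  proof -
    \<comment> \<open>Convergence at \<open>r\<close> makes both series absolutely convergent at
      \<open>z\<close>, as the Cauchy product requires.\<close>
    obtain r where r: "cmod z < r" "r < 1"
      using z dense[of "cmod z" 1] by auto
    have r0: "0 \<le> r" using r(1) norm_ge_zero[of z] by linarith
    have abs: "summable (\<lambda>n. cmod (a n * z ^ n))"
      if "\<And>w. w \<in> unit_disk \<Longrightarrow> (\<lambda>n. a n * w ^ n) sums g w" for a g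
      by (rule powser_insidea[of a "of_real r"])
        (use that[of "of_real r"] r r0 in \<open>auto simp: sums_iff\<close>)
    have "(\<lambda>n. \<Sum>i\<le>n. (taylor_coeff \<psi> i * z ^ i) * (hcoeff f (n - i) * z ^ (n - i)))
        sums ((\<Sum>n. taylor_coeff \<psi> n * z ^ n) * (\<Sum>n. hcoeff f n * z ^ n))"
      by (intro Cauchy_product_sums abs[OF taylor_coeff_sums[OF hol]] abs[OF hcoeff_sums])
    moreover have "(\<Sum>i\<le>n. (taylor_coeff \<psi> i * z ^ i) * (hcoeff f (n - i) * z ^ (n - i)))
        = ?b f n * z ^ n" for n
      unfolding sum_distrib_right
    proof (intro sum.cong refl)
      fix i assume "i \<in> {..n}"
      then have "z ^ n = z ^ i * z ^ (n - i)" by (simp flip: power_add)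
      then show "taylor_coeff \<psi> i * z ^ i * (hcoeff f (n - i) * z ^ (n - i))
          = taylor_coeff \<psi> i * hcoeff f (n - i) * z ^ n" by (simp only: mult_ac)
    qed
    ultimately show ?thesis
      using taylor_coeff_sums[OF hol z] hcoeff_sums[OF z, of f] by (simp add: sums_iff)
  qed
  have bound: "(\<Sum>n<K. (cmod (?b f n))\<^sup>2) \<le> M\<^sup>2 * (norm f)\<^sup>2" for f K
    unfolding norm_sq_hardy2
    by (rule dominated_power_series_coeff_bound[OF hcoeff_sums sums _ square_summable_hcoeff])
      (auto simp: norm_mult intro!: mult_right_mono le)
  have sq: "square_summable (?b f)" for f
    using bound[of f] by (intro summableI_nonneg_bounded) auto
  show coeff: "hcoeff (mult_op \<psi> f) n = ?b f n" for f n
    unfolding mult_op_def by (rule on_disk_power_series(2)[OF sq sums])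
  show "bounded_clinear (mult_op \<psi>)"
    unfolding bounded_clinear_def
  proof (intro conjI allI bounded_linear_intro)
    show "mult_op \<psi> (f + g) = mult_op \<psi> f + mult_op \<psi> g" for f g
      by (rule hardy2_eqI) (simp add: coeff hcoeff_simps distrib_left sum.distrib)
    show homog: "mult_op \<psi> (c *\<^sub>H f) = c *\<^sub>H mult_op \<psi> f" for c f
      by (rule hardy2_eqI) (simp add: coeff hcoeff_simps sum_distrib_left mult_ac)
    show "mult_op \<psi> (r *\<^sub>R f) = r *\<^sub>R mult_op \<psi> f" for r f
      by (simp add: scaleR_eq_scaleH homog)
    show "norm (mult_op \<psi> f) \<le> norm f * M" for f
    proof (rule power2_le_imp_le)
      show "(norm (mult_op \<psi> f))\<^sup>2 \<le> (norm f * M)\<^sup>2"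
        unfolding norm_sq_hardy2[of "mult_op \<psi> f"] coeff
        by (rule suminf_le_const[OF sq]) (use bound in \<open>simp add: power_mult_distrib mult.commute\<close>)
    qed (use M in simp)
  qed
qed

text \<open>Bounded functions lie in the Hardy space: \<phi> is the image of the constant 1 under
  multiplication by \<phi>.\<close>

lemma Hinf_hcoeff:
  assumes "\<phi> \<in> Hinf"
  obtains F where "\<And>n. hcoeff F n = taylor_coeff \<phi> n"
proof
  show "hcoeff (mult_op \<phi> (monomial 0)) n = taylor_coeff \<phi> n" for n
    by (simp add: hcoeff_mult_op[OF assms] hcoeff_monomial if_distrib[of "\<lambda>x. _ * x"] cong: if_cong)
qed

lemma Hinf_conjugate:
  assumes "\<phi> \<in> Hinf"
  shows "(\<lambda>z. cnj (\<phi> (cnj z))) \<in> Hinf"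
    and "taylor_coeff (\<lambda>z. cnj (\<phi> (cnj z))) n = cnj (taylor_coeff \<phi> n)"
proof -
  obtain M where hol: "\<phi> holomorphic_on unit_disk"
    and le: "\<And>z. z \<in> unit_disk \<Longrightarrow> cmod (\<phi> z) \<le> M"
    using HinfE[OF assms] by blast
  have sums: "(\<lambda>n. cnj (taylor_coeff \<phi> n) * z ^ n) sums cnj (\<phi> (cnj z))" if "z \<in> unit_disk" for z
  proof -
    have "(\<lambda>n. cnj (taylor_coeff \<phi> n * cnj z ^ n)) sums cnj (\<phi> (cnj z))"
      unfolding sums_cnj using that by (intro taylor_coeff_sums hol) simp
    then show ?thesis by simp
  qed
  show "taylor_coeff (\<lambda>z. cnj (\<phi> (cnj z))) n = cnj (taylor_coeff \<phi> n)"
    by (rule taylor_coeff_unique(2)[OF sums])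
  show "(\<lambda>z. cnj (\<phi> (cnj z))) \<in> Hinf"
    unfolding Hinf_def bounded_iff using taylor_coeff_unique(1)[OF sums] le
    by (auto intro!: exI[of _ M])
qed

text \<open>Coefficient \<open>m\<close> of \<open>phi_B \<phi> f\<close> is its pairing with
  \<open>z^m\<close>, hence the pairing of \<open>f\<close> with the conjugated symbol times
  \<open>z^m\<close>. The latter has the conjugated coefficients moved up by \<open>m\<close>, and
  the two conjugations cancel.\<close>

lemma has_symbol_dilation_phi_B:
  assumes \<phi>: "\<phi> \<in> Hinf" and l: "cmod l \<le> 1" and F: "\<And>n. hcoeff F n = taylor_coeff \<phi> n"
  shows "has_symbol l F (dilation l \<circ> phi_B \<phi>)"
  unfolding has_symbol_def
proof (intro allI)
  fix f m
  let ?T = "mult_op (\<lambda>z. cnj (\<phi> (cnj z)))"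
  note conj = Hinf_conjugate[OF \<phi>]
  have "hcoeff (?T (monomial m)) n = (if n < m then 0 else cnj (hcoeff F (n - m)))" for n
  proof -
    have "hcoeff (?T (monomial m)) n
        = (\<Sum>i\<le>n. if i = n - m then (if n < m then 0 else cnj (hcoeff F (n - m))) else 0)"
      unfolding hcoeff_mult_op[OF conj(1)] conj(2)
      by (intro sum.cong refl) (auto simp: hcoeff_monomial F)
    then show ?thesis by simp
  qed
  then have prod: "hcoeff f n * cnj (hcoeff (?T (monomial m)) n)
      = (if n < m then 0 else hcoeff F (n - m) * hcoeff f n)" for n
    by simp
  let ?g = "\<lambda>n. if n < m then 0 else hcoeff F (n - m) * hcoeff f n"
  have "hcoeff (phi_B \<phi> f) m = cinner f (?T (monomial m))"
    unfolding cinner_monomial[symmetric] phi_B_def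
    by (rule hadjoint_cinner[OF bounded_clinear_mult_op[OF conj(1)]])
  also have "\<dots> = suminf ?g"
    unfolding cinner_def prod ..
  also have "\<dots> = (\<Sum>k. ?g (k + m)) + (\<Sum>n<m. ?g n)"
    using cinner_summable[of f "?T (monomial m)"] unfolding prod
    by (rule suminf_split_initial_segment)
  also have "\<dots> = (\<Sum>k. hcoeff F k * hcoeff f (k + m))"
    by simp
  finally show "hcoeff ((dilation l \<circ> phi_B \<phi>) f) m = l ^ m * (\<Sum>k. hcoeff F k * hcoeff f (k + m))"
    by (simp add: hcoeff_dilation[OF l])
qed

text \<open>For \<open>\<bar>l\<bar> = 1\<close>, the operator maps the kernel function \<open>\<Sum>n. w\<^sup>n z\<^sup>n\<close> to a function
  of norm \<open>\<bar>\<phi> w\<bar>\<close> times as large.\<close>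

lemma has_symbol_unimodular_Hinf:
  assumes X: "bounded_clinear X" and sym: "has_symbol l \<phi> X" and l: "cmod l = 1"
  shows "hfun \<phi> \<in> Hinf"
proof -
  obtain C where C: "\<And>f. norm (X f) \<le> norm f * C"
    using X bounded_linear.bounded unfolding bounded_clinear_def by blast
  have "cmod (hfun \<phi> w) \<le> C" if w: "w \<in> unit_disk" for w
  proof -
    obtain k where k: "\<And>n. hcoeff k n = w ^ n"
      using hardy2_of_hcoeff[OF square_summable_power[OF w]] by blast
    \<comment> \<open>The kernel \<open>k\<close> satisfies \<open>B k = w k\<close>, so the symbol
      series sums to \<open>w ^ m\<close> times the value at \<open>w\<close>.\<close>
    have "hcoeff (X k) m = (l * w) ^ m * hfun \<phi> w" for m
    proof -
      have "(\<lambda>n. w ^ m * (hcoeff \<phi> n * w ^ n)) sums (w ^ m * hfun \<phi> w)"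
        by (intro sums_mult hcoeff_sums w)
      then show ?thesis
        by (simp add: has_symbolD[OF sym] k power_add power_mult_distrib sums_iff mult_ac)
    qed
    \<comment> \<open>Here |l| = 1 enters: the factors \<open>l ^ m\<close> do not change the moduli
      of the coefficients.\<close>
    then have "(norm (X k))\<^sup>2 = (norm (hfun \<phi> w *\<^sub>H k))\<^sup>2"
      unfolding norm_sq_hardy2 by (simp add: hcoeff_simps k norm_mult norm_power l mult.commute)
    then have "norm (X k) = cmod (hfun \<phi> w) * norm k"
      by (simp add: norm_scaleH power2_eq_iff_nonneg)
    moreover have "norm k > 0"
      using norm_hcoeff_le[of k 0] unfolding k power_0 norm_one by linarith
    ultimately show ?thesis
      using C[of k] by (simp add: mult.commute)
  qed
  then show ?thesis
    unfolding Hinf_def bounded_iff using hfun_holomorphic by (auto intro!: exI[of _ C])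
qed

section \<open>The case of modulus less than one\<close>

text \<open>The inner sum pairs \<open>B\<^sup>m f\<close> with a fixed vector and is at most
  \<open>norm f * norm \<psi>\<close>, since \<open>B\<close> is a contraction. The weights
  \<open>l ^ m\<close> are square summable, so the rows form a bounded operator.\<close>

lemma bounded_clinear_has_symbol_exists:
  assumes l: "cmod l < 1"
  obtains T where "bounded_clinear T" "has_symbol l \<phi> T"
proof -
  \<comment> \<open>Conjugated coefficients offset the conjugation in the second argument of
    \<open>cinner\<close>.\<close>
  obtain \<psi> where \<psi>: "\<And>n. hcoeff \<psi> n = cnj (hcoeff \<phi> n)"
    using hardy2_of_hcoeff[of "\<lambda>n. cnj (hcoeff \<phi> n)"] square_summable_hcoeff[of \<phi>] by auto
  let ?p = "\<lambda>f m. cinner ((backward_shift ^^ m) f) \<psi>"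
  have p_eq: "?p f m = (\<Sum>k. hcoeff \<phi> k * hcoeff f (k + m))" for f m
    by (simp add: cinner_def \<psi> hcoeff_backward_shift_funpow mult.commute)
  have add: "?p (f + g) m = ?p f m + ?p g m" for f g m
  proof -
    have "(backward_shift ^^ m) (f + g) = (backward_shift ^^ m) f + (backward_shift ^^ m) g"
      by (rule hardy2_eqI) (simp add: hcoeff_backward_shift_funpow hcoeff_simps)
    then show ?thesis by (simp add: cinner_add_left)
  qed
  have homog: "?p (c *\<^sub>H f) m = c * ?p f m" for c f m
  proof -
    have "(backward_shift ^^ m) (c *\<^sub>H f) = c *\<^sub>H (backward_shift ^^ m) f"
      by (rule hardy2_eqI) (simp add: hcoeff_backward_shift_funpow hcoeff_simps)
    then show ?thesis by (simp add: cinner_scaleH_left)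
  qed
  have p_le: "cmod (?p f m) \<le> norm f * norm \<psi>" for f m
  proof -
    have "(norm ((backward_shift ^^ m) f))\<^sup>2 \<le> (norm f)\<^sup>2"
      unfolding norm_sq_hardy2 hcoeff_backward_shift_funpow
      using suminf_split_initial_segment[OF square_summable_hcoeff[of f], of m]
      by (simp add: sum_nonneg)
    then have "norm ((backward_shift ^^ m) f) \<le> norm f"
      by (rule power2_le_imp_le) simp
    then have "norm ((backward_shift ^^ m) f) * norm \<psi> \<le> norm f * norm \<psi>"
      by (rule mult_right_mono) simp
    then show ?thesis
      using norm_cinner_le[of "(backward_shift ^^ m) f" \<psi>] by linarith
  qed
  let ?q = "\<lambda>m. ((cmod l)\<^sup>2) ^ m"
  have "(cmod l)\<^sup>2 < 1" using l by (simp add: abs_square_less_1)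
  then have q: "summable ?q" by (intro summable_geometric) simp
  have term_le: "(cmod (l ^ m * ?p f m))\<^sup>2 \<le> ?q m * (norm f * norm \<psi>)\<^sup>2" for f m
    unfolding norm_mult norm_power power_mult_distrib[of "cmod l ^ m"] power_mult[symmetric]
      mult.commute[of m 2]
    by (intro mult_left_mono power_mono p_le) simp_all
  have sq: "square_summable (\<lambda>m. l ^ m * ?p f m)" for f
    by (rule summable_comparison_test[OF _ summable_mult2[OF q, of "(norm f * norm \<psi>)\<^sup>2"]])
      (use term_le in auto)
  have "\<exists>g. \<forall>m. hcoeff g m = l ^ m * ?p f m" for f
    by (rule hardy2_of_hcoeff[OF sq])
  then obtain T where T: "\<And>f m. hcoeff (T f) m = l ^ m * ?p f m"
    by metis
  have T_homog: "T (c *\<^sub>H f) = c *\<^sub>H T f" for c f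
    by (rule hardy2_eqI) (simp add: T homog hcoeff_simps)
  have "bounded_linear T"
  proof (rule bounded_linear_intro)
    show "T (f + g) = T f + T g" for f g
      by (rule hardy2_eqI) (simp add: T add hcoeff_simps distrib_left)
    show "T (r *\<^sub>R f) = r *\<^sub>R T f" for r f
      by (simp add: scaleR_eq_scaleH T_homog)
    show "norm (T f) \<le> norm f * (norm \<psi> * sqrt (suminf ?q))" for f
    proof (rule power2_le_imp_le)
      have "(norm (T f))\<^sup>2 \<le> (\<Sum>m. ?q m * (norm f * norm \<psi>)\<^sup>2)"
        unfolding norm_sq_hardy2 T
        by (rule suminf_le[OF term_le sq summable_mult2[OF q]])
      also have "\<dots> = (norm f * (norm \<psi> * sqrt (suminf ?q)))\<^sup>2"
        using suminf_nonneg[OF q] by (simp add: suminf_mult2[OF q, symmetric] power_mult_distrib)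
      finally show "(norm (T f))\<^sup>2 \<le> (norm f * (norm \<psi> * sqrt (suminf ?q)))\<^sup>2" .
    qed (use suminf_nonneg[OF q] in simp)
  qed
  then have "bounded_clinear T"
    by (simp add: bounded_clinear_def T_homog)
  moreover have "has_symbol l \<phi> T"
    by (simp add: has_symbol_def T p_eq)
  ultimately show ?thesis by (rule that)
qed

lemma has_symbol_imp_is_dilation_phi_B:
  assumes "bounded_clinear T" "has_symbol l \<phi> T"
  shows "is_dilation_phi_B l \<phi> T"
  unfolding is_dilation_phi_B_def
proof (intro conjI allI hardy2_eqI)
  fix n m
  have "hcoeff (\<Sum>k\<le>n. (hcoeff \<phi> k * l ^ (n - k)) *\<^sub>H monomial (n - k)) m
      = (\<Sum>k\<le>n. if k = n - m then (if m \<le> n then l ^ m * hcoeff \<phi> (n - m) else 0) else 0)"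
    unfolding hcoeff_sum hcoeff_scaleH
    by (intro sum.cong refl) (auto simp: hcoeff_monomial)
  then show "hcoeff (T (monomial n)) m
      = hcoeff (\<Sum>k\<le>n. (hcoeff \<phi> k * l ^ (n - k)) *\<^sub>H monomial (n - k)) m"
    by (simp add: has_symbol_monomial[OF assms(2)])
qed (rule assms(1))

text \<open>The operator just constructed has the prescribed values on monomials, and bounded
  operators that agree on monomials coincide; so the definite description denotes it.\<close>

lemma dilation_phi_B_props:
  assumes "cmod l < 1"
  shows "\<exists>!T. is_dilation_phi_B l \<phi> T"
    and "bounded_clinear (dilation_phi_B l \<phi>)"
    and "has_symbol l \<phi> (dilation_phi_B l \<phi>)"
proof -
  obtain T where T: "bounded_clinear T" "has_symbol l \<phi> T"
    using bounded_clinear_has_symbol_exists[OF assms] by blast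
  have dil: "is_dilation_phi_B l \<phi> T"
    by (rule has_symbol_imp_is_dilation_phi_B[OF T])
  have uniq: "S = T" if "is_dilation_phi_B l \<phi> S" for S
    using that dil by (intro bounded_clinear_eqI) (auto simp: is_dilation_phi_B_def)
  from dil uniq show "\<exists>!T. is_dilation_phi_B l \<phi> T" by blast
  have "dilation_phi_B l \<phi> = T"
    unfolding dilation_phi_B_def using dil uniq by (rule the_equality)
  with T show "bounded_clinear (dilation_phi_B l \<phi>)" "has_symbol l \<phi> (dilation_phi_B l \<phi>)"
    by simp_all
qed

section \<open>Nonzero symbols and the two equivalences\<close>

lemma hfun_zero: "hfun 0 z = 0"
proof (cases "z \<in> unit_disk")
  case True
  from hcoeff_sums[OF this, of 0] have "(\<lambda>n. 0) sums hfun 0 z"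
    by (simp add: hcoeff_simps)
  then show ?thesis
    using sums_unique2 sums_zero by blast
qed (rule hfun_outside)

text \<open>Links the two notions of a nonzero symbol: a nonzero Hardy space element, and a function
  that is nonzero somewhere on the disk.\<close>

lemma hardy2_eq_0_iff: "f = 0 \<longleftrightarrow> (\<forall>z\<in>unit_disk. hfun f z = 0)"
proof
  assume "\<forall>z\<in>unit_disk. hfun f z = 0"
  then have "hfun f = hfun 0"
    using hfun_outside[of _ f] by (intro ext) (metis hfun_zero)
  then show "f = 0" by (simp add: hfun_inject)
qed (simp add: hfun_zero)

theorem theorem3p1:
  fixes l :: complex and X :: "hardy2 \<Rightarrow> hardy2"
  assumes "l \<in> cball 0 1" and "bounded_clinear X"
  shows "(cmod l = 1 \<longrightarrow>
            (extended_eigenoperator l X \<longleftrightarrow>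
              (\<exists>\<phi>\<in>Hinf. (\<exists>z\<in>unit_disk. \<phi> z \<noteq> 0) \<and> X = dilation l \<circ> phi_B \<phi>)))
       \<and> (cmod l < 1 \<longrightarrow>
            (extended_eigenoperator l X \<longleftrightarrow>
              (\<exists>\<phi>. \<phi> \<noteq> 0 \<and> X = dilation_phi_B l \<phi>))
            \<and> (\<forall>\<phi>. (\<exists>!T. is_dilation_phi_B l \<phi> T) \<and> bounded_clinear (dilation_phi_B l \<phi>)))"
proof (intro conjI impI)
  assume l: "cmod l = 1"
  show "extended_eigenoperator l X \<longleftrightarrow>
      (\<exists>\<phi>\<in>Hinf. (\<exists>z\<in>unit_disk. \<phi> z \<noteq> 0) \<and> X = dilation l \<circ> phi_B \<phi>)"
  proof
    assume eig: "extended_eigenoperator l X"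
    then obtain F where F: "has_symbol l F X"
      by (rule extended_eigenoperator_has_symbol)
    have Hinf: "hfun F \<in> Hinf"
      by (rule has_symbol_unimodular_Hinf[OF assms(2) F l])
    have "X = dilation l \<circ> phi_B (hfun F)"
      using l by (intro has_symbol_unique[OF F] has_symbol_dilation_phi_B[OF Hinf])
        (simp_all add: hcoeff_def)
    moreover have "\<exists>z\<in>unit_disk. hfun F z \<noteq> 0"
      using eig has_symbol_extended_eigenoperator_iff[OF assms(2) F] hardy2_eq_0_iff[of F] by blast
    ultimately show "\<exists>\<phi>\<in>Hinf. (\<exists>z\<in>unit_disk. \<phi> z \<noteq> 0) \<and> X = dilation l \<circ> phi_B \<phi>"
      using Hinf by blast
  next
    assume "\<exists>\<phi>\<in>Hinf. (\<exists>z\<in>unit_disk. \<phi> z \<noteq> 0) \<and> X = dilation l \<circ> phi_B \<phi>"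
    then obtain \<phi> z where \<phi>: "\<phi> \<in> Hinf" and z: "z \<in> unit_disk" "\<phi> z \<noteq> 0"
      and X: "X = dilation l \<circ> phi_B \<phi>" by blast
    obtain F where F: "\<And>n. hcoeff F n = taylor_coeff \<phi> n"
      using Hinf_hcoeff[OF \<phi>] by blast
    \<comment> \<open>\<phi> is arbitrary off the disk, where \<open>hfun F\<close> is 0, so the two
      are compared only at a point of the disk.\<close>
    have "hfun F z = \<phi> z"
      using hcoeff_sums[OF z(1), of F] taylor_coeff_sums[of \<phi> z] \<phi> z(1)
      by (auto simp: F Hinf_def sums_iff)
    then have "F \<noteq> 0"
      using z hardy2_eq_0_iff[of F] by auto
    moreover have "has_symbol l F X"
      unfolding X using l by (intro has_symbol_dilation_phi_B[OF \<phi>] F) simp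
    ultimately show "extended_eigenoperator l X"
      by (simp add: has_symbol_extended_eigenoperator_iff[OF assms(2)])
  qed
next
  assume l: "cmod l < 1"
  show "extended_eigenoperator l X \<longleftrightarrow> (\<exists>\<phi>. \<phi> \<noteq> 0 \<and> X = dilation_phi_B l \<phi>)"
  proof
    assume eig: "extended_eigenoperator l X"
    then obtain \<phi> where \<phi>: "has_symbol l \<phi> X"
      by (rule extended_eigenoperator_has_symbol)
    have "\<phi> \<noteq> 0"
      using eig has_symbol_extended_eigenoperator_iff[OF assms(2) \<phi>] by simp
    moreover have "X = dilation_phi_B l \<phi>"
      by (rule has_symbol_unique[OF \<phi> dilation_phi_B_props(3)[OF l]])
    ultimately show "\<exists>\<phi>. \<phi> \<noteq> 0 \<and> X = dilation_phi_B l \<phi>" by blast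
  next
    assume "\<exists>\<phi>. \<phi> \<noteq> 0 \<and> X = dilation_phi_B l \<phi>"
    then obtain \<phi> where "\<phi> \<noteq> 0" "has_symbol l \<phi> X"
      using dilation_phi_B_props(3)[OF l] by blast
    then show "extended_eigenoperator l X"
      using has_symbol_extended_eigenoperator_iff[OF assms(2)] by blast
  qed
next
  assume l: "cmod l < 1"
  show "\<forall>\<phi>. (\<exists>!T. is_dilation_phi_B l \<phi> T) \<and> bounded_clinear (dilation_phi_B l \<phi>)"
    using dilation_phi_B_props(1,2)[OF l] by blast
qed

end
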